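(* Let $A\subset\mathbb{R}^m$ be a finite set whose convex hull $P=\mathrm{conv}(A)$ has dimension $m$, and let $\alpha_a>0$ for $a\in A$. Let $\Phi(x)=\frac12\log\sum_{a\in A}\alpha_a^2e^{2\langle a,x\rangle}$. Then the moment map $$\mu(x):=D_x\Phi=\sum_{a\in A}\frac{\alpha_a^2e^{2\langle a,x\rangle}}{\sum_{a'\in A}\alpha_{a'}^2e^{2\langle a',x\rangle}}\,a$$ is a diffeomorphism $\mu:\mathbb{R}^m\to\mathrm{int}(P)$ onto the interior of $P$.
   Context: $\mathbb{R}^m$ is identified with its dual by the standard scalar product, so that $D_x\Phi$ is the gradient of $\Phi$ at $x$. *)

theory Defs
  imports "HOL-Analysis.Analysis"
begin

text \<open>
  Maps of class \<open>C\<^sup>k\<close> on an open set, by recursion over directional derivatives. In finite dimension,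
  continuity of \<open>x \<mapsto> Df(x) v\<close> for each fixed \<open>v\<close> is continuity of \<open>Df\<close>, so this is the usual
  notion. Derivatives are taken at unrestricted \<open>at x\<close>; the set is meant to be open.
\<close>

primrec Ck_on :: "nat \<Rightarrow> 'a::euclidean_space set \<Rightarrow> ('a \<Rightarrow> 'b::euclidean_space) \<Rightarrow> bool" where
  "Ck_on 0 S f \<longleftrightarrow> continuous_on S f"
| "Ck_on (Suc k) S f \<longleftrightarrow>
     (\<forall>x\<in>S. f differentiable (at x)) \<and> (\<forall>v. Ck_on k S (\<lambda>x. frechet_derivative f (at x) v))"

definition smooth_on :: "'a::euclidean_space set \<Rightarrow> ('a \<Rightarrow> 'b::euclidean_space) \<Rightarrow> bool" where
  "smooth_on S f \<longleftrightarrow> (\<forall>k. Ck_on k S f)"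

definition diffeomorphism ::
    "'a::euclidean_space set \<Rightarrow> 'b::euclidean_space set \<Rightarrow> ('a \<Rightarrow> 'b) \<Rightarrow> bool" where
  "diffeomorphism S T f \<longleftrightarrow>
     open S \<and> open T \<and> bij_betw f S T \<and> smooth_on S f \<and> smooth_on T (inv_into S f)"

definition Phi :: "(real^'m) set \<Rightarrow> (real^'m \<Rightarrow> real) \<Rightarrow> real^'m \<Rightarrow> real" where
  "Phi A \<alpha> x = (1/2) * ln (\<Sum>a\<in>A. (\<alpha> a)\<^sup>2 * exp (2 * (a \<bullet> x)))"

text \<open>
  The moment map is by definition the gradient. That the gradient exists, so that the
  description is proper, is a claim about \<open>Phi\<close> and not part of the definition.
\<close>

definition moment_map :: "(real^'m) set \<Rightarrow> (real^'m \<Rightarrow> real) \<Rightarrow> real^'m \<Rightarrow> real^'m" where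
  "moment_map A \<alpha> x = (THE D. GDERIV (Phi A \<alpha>) x :> D)"

end

theory Submission
  imports Defs
begin

text \<open>
  The derivative of \<open>\<mu>\<close> at \<open>x\<close> is twice the covariance of the probability weights on \<open>A\<close>, hence
  positive definite because \<open>A\<close> lies in no hyperplane. So \<open>\<mu>\<close> is injective and its image is open in
  \<open>P\<close>; conversely, for \<open>b\<close> in the interior the function \<open>x \<mapsto> \<Phi> x - \<langle>b, x\<rangle>\<close> is coercive, and
  \<open>\<mu> = b\<close> at its minimum.
\<close>

section \<open>Calculus of \<open>Ck_on\<close>: closure under the operations that occur in the
  moment map\<close>

text \<open>Each point of the open set \<open>S\<close> has a neighbourhood on which the two maps
  agree, so their derivatives there coincide; the induction then passes to the directional
  derivatives.\<close>

lemma Ck_on_cong: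
  assumes "open S" "\<And>x. x \<in> S \<Longrightarrow> f x = g x"
  shows "Ck_on k S f \<longleftrightarrow> Ck_on k S g"
  using assms(2)
proof (induction k arbitrary: f g)
  case 0
  then show ?case
    unfolding Ck_on.simps by (intro continuous_on_cong refl)
next
  case (Suc k)
  have deriv: "(f has_derivative D) (at x) \<longleftrightarrow> (g has_derivative D) (at x)" if "x \<in> S" for x D
  proof
    assume "(f has_derivative D) (at x)"
    then show "(g has_derivative D) (at x)"
      using assms(1) that Suc.prems by (rule has_derivative_transform_within_open)
  next
    assume "(g has_derivative D) (at x)"
    then show "(f has_derivative D) (at x)"
      using assms(1) that Suc.prems[symmetric] by (rule has_derivative_transform_within_open)
  qed
  \<comment> \<open>\<open>frechet_derivative\<close> is a choice among the derivatives, so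
    equivalent derivative predicates give the same choice.\<close>
  then have "Ck_on k S (\<lambda>x. frechet_derivative f (at x) v)
      \<longleftrightarrow> Ck_on k S (\<lambda>x. frechet_derivative g (at x) v)" for v
    by (intro Suc.IH) (simp add: frechet_derivative_def)
  moreover have "(\<forall>x\<in>S. f differentiable (at x)) \<longleftrightarrow> (\<forall>x\<in>S. g differentiable (at x))"
    using deriv unfolding differentiable_def by (intro ball_cong refl) simp
  ultimately show ?case
    by simp
qed

text \<open>Replaces the chosen derivative by an explicit formula \<open>f'\<close>, which has to be
  correct on \<open>S\<close> only. Every later closure proof ends with this rule.\<close>

lemma Ck_on_SucI:
  assumes "open S"
    and "\<And>x. x \<in> S \<Longrightarrow> (f has_derivative f' x) (at x)"
    and "\<And>v. Ck_on k S (\<lambda>x. f' x v)"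
  shows "Ck_on (Suc k) S f"
proof -
  have "frechet_derivative f (at x) = f' x" if "x \<in> S" for x
    using assms(2)[OF that] frechet_derivative_at by metis
  then have "Ck_on k S (\<lambda>x. frechet_derivative f (at x) v)" for v
    using assms(3) by (subst Ck_on_cong[OF assms(1), where g = "\<lambda>x. f' x v"]) simp_all
  with assms(2) show ?thesis
    by (auto simp: differentiable_def)
qed

lemma Ck_on_SucD:
  "Ck_on (Suc k) S f \<Longrightarrow> x \<in> S \<Longrightarrow> (f has_derivative frechet_derivative f (at x)) (at x)"
  by (simp add: frechet_derivative_works)

text \<open>In the rules for products, inverses and exponentials the derivative still contains the
  undifferentiated functions, and the induction needs these at the lower order.\<close>

lemma Ck_on_Suc_imp: "Ck_on (Suc k) S f \<Longrightarrow> Ck_on k S f"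
proof (induction k arbitrary: f)
  case 0
  then show ?case
    by (simp add: differentiable_at_imp_differentiable_on differentiable_imp_continuous_on)
next
  case (Suc k)
  have "\<forall>x\<in>S. f differentiable (at x)"
    and "Ck_on (Suc k) S (\<lambda>x. frechet_derivative f (at x) v)" for v
    using Suc.prems unfolding Ck_on.simps(2)[of "Suc k"] by (rule conjunct1, elim conjE allE)
  then show ?case
    unfolding Ck_on.simps(2)[of k S f] by (intro conjI allI Suc.IH)
qed

lemma smooth_on_imp_continuous_on: "smooth_on S f \<Longrightarrow> continuous_on S f"
  by (metis Ck_on.simps(1) smooth_on_def)

lemma smooth_on_imp_has_derivative:
  "smooth_on S f \<Longrightarrow> x \<in> S \<Longrightarrow> (f has_derivative frechet_derivative f (at x)) (at x)"
  unfolding smooth_on_def by (rule Ck_on_SucD[of 0]) simp_all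

lemma smooth_on_imp_Ck_on_derivative:
  "smooth_on S f \<Longrightarrow> Ck_on k S (\<lambda>x. frechet_derivative f (at x) v)"
  unfolding smooth_on_def by (drule spec[of _ "Suc k"]) simp

lemma Ck_on_const: "Ck_on k S (\<lambda>x. c)"
proof (induction k arbitrary: c)
  case (Suc k)
  show ?case
    using Suc[of 0] by (simp add: frechet_derivative_const)
qed simp

lemma Ck_on_bounded_linear_left:
  assumes "open S" "bounded_linear h" "Ck_on k S f"
  shows "Ck_on k S (\<lambda>x. h (f x))"
  using assms(3)
proof (induction k arbitrary: f)
  case 0
  then show ?case
    using bounded_linear.continuous_on[OF assms(2)] by simp
next
  case (Suc k)
  have D: "Ck_on k S (\<lambda>x. h (frechet_derivative f (at x) v))" for v
    by (rule Suc.IH) (use Suc.prems in simp)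
  have "((\<lambda>x. h (f x)) has_derivative (\<lambda>v. h (frechet_derivative f (at x) v))) (at x)"
    if "x \<in> S" for x
    using that Suc.prems by (intro bounded_linear.has_derivative[OF assms(2)] Ck_on_SucD)
  then show ?case
    by (rule Ck_on_SucI[OF assms(1) _ D])
qed

text \<open>The derivative is \<open>h\<close> at every point, so in a fixed direction it is
  constant and no induction is required.\<close>

lemma Ck_on_bounded_linear:
  assumes "open S" "bounded_linear h"
  shows "Ck_on k S h"
proof (cases k)
  case 0
  then show ?thesis using assms(2) linear_continuous_on by auto
next
  case (Suc n)
  show ?thesis unfolding Suc
    by (rule Ck_on_SucI[OF assms(1) bounded_linear_imp_has_derivative[OF assms(2)] Ck_on_const])
qed

lemma Ck_on_add:
  assumes "open S" "Ck_on k S f" "Ck_on k S g"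
  shows "Ck_on k S (\<lambda>x. f x + g x)"
  using assms(2,3)
proof (induction k arbitrary: f g)
  case 0
  then show ?case by (simp add: continuous_on_add)
next
  case (Suc k)
  have D: "Ck_on k S (\<lambda>x. frechet_derivative f (at x) v + frechet_derivative g (at x) v)" for v
    by (rule Suc.IH) (use Suc.prems in simp_all)
  have "((\<lambda>x. f x + g x) has_derivative
      (\<lambda>v. frechet_derivative f (at x) v + frechet_derivative g (at x) v)) (at x)" if "x \<in> S" for x
    using that Suc.prems by (intro has_derivative_add Ck_on_SucD)
  then show ?case
    by (rule Ck_on_SucI[OF assms(1) _ D])
qed

lemma Ck_on_sum:
  assumes "open S" "\<And>i. i \<in> I \<Longrightarrow> Ck_on k S (f i)"
  shows "Ck_on k S (\<lambda>x. \<Sum>i\<in>I. f i x)"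
  using assms(2)
proof (induction I rule: infinite_finite_induct)
  case (insert i I)
  then have "Ck_on k S (\<lambda>x. f i x + (\<Sum>i\<in>I. f i x))"
    by (intro Ck_on_add assms(1)) simp_all
  with insert.hyps show ?case
    by simp
qed (simp_all add: Ck_on_const)

text \<open>The product rule yields a sum of two terms of the same bilinear shape, with one argument
  replaced by its derivative; hence the induction over all \<open>f\<close> and
  \<open>g\<close>.\<close>

lemma Ck_on_bilinear:
  assumes "open S" "bounded_bilinear b" "Ck_on k S f" "Ck_on k S g"
  shows "Ck_on k S (\<lambda>x. b (f x) (g x))"
  using assms(3,4)
proof (induction k arbitrary: f g)
  case 0
  then show ?case using bounded_bilinear.continuous_on[OF assms(2)] by simp
next
  case (Suc k)
  have "Ck_on k S f" "Ck_on k S g"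
    using Suc.prems Ck_on_Suc_imp by blast+
  moreover have "Ck_on k S (\<lambda>x. frechet_derivative f (at x) v)"
    "Ck_on k S (\<lambda>x. frechet_derivative g (at x) v)" for v
    using Suc.prems by simp_all
  ultimately have D: "Ck_on k S (\<lambda>x. b (f x) (frechet_derivative g (at x) v)
      + b (frechet_derivative f (at x) v) (g x))" for v
    by (intro Ck_on_add Suc.IH assms(1))
  have "((\<lambda>x. b (f x) (g x)) has_derivative (\<lambda>v. b (f x) (frechet_derivative g (at x) v)
      + b (frechet_derivative f (at x) v) (g x))) (at x)" if "x \<in> S" for x
    using that Suc.prems by (intro bounded_bilinear.FDERIV[OF assms(2)] Ck_on_SucD)
  then show ?case
    by (rule Ck_on_SucI[OF assms(1) _ D])
qed

lemmas Ck_on_scaleR = Ck_on_bilinear[OF _ bounded_bilinear_scaleR]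
lemmas Ck_on_mult = Ck_on_bilinear[OF _ bounded_bilinear_mult]

lemma Ck_on_prod:
  fixes f :: "'i \<Rightarrow> 'a::euclidean_space \<Rightarrow> real"
  assumes "open S" "\<And>i. i \<in> I \<Longrightarrow> Ck_on k S (f i)"
  shows "Ck_on k S (\<lambda>x. \<Prod>i\<in>I. f i x)"
  using assms(2)
proof (induction I rule: infinite_finite_induct)
  case (insert i I)
  then have "Ck_on k S (\<lambda>x. f i x * (\<Prod>i\<in>I. f i x))"
    by (intro Ck_on_mult assms(1)) simp_all
  with insert.hyps show ?case
    by simp
qed (simp_all add: Ck_on_const)

text \<open>The derivative is a product of \<open>inverse (f x)\<close> with itself and the
  derivative of \<open>f\<close>, so the induction hypothesis for the same \<open>f\<close>
  suffices. The exponential below reproduces itself in the same way.\<close>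

lemma Ck_on_inverse:
  fixes f :: "'a::euclidean_space \<Rightarrow> real"
  assumes "open S" "\<And>x. x \<in> S \<Longrightarrow> f x \<noteq> 0" "Ck_on k S f"
  shows "Ck_on k S (\<lambda>x. inverse (f x))"
  using assms(3)
proof (induction k)
  case 0
  then show ?case using assms(2) by (simp add: continuous_on_inverse)
next
  case (Suc k)
  have "Ck_on k S (\<lambda>x. inverse (f x))" "Ck_on k S (\<lambda>x. frechet_derivative f (at x) v)" for v
    using Suc Ck_on_Suc_imp[OF Suc.prems] by simp_all
  then have D: "Ck_on k S (\<lambda>x. - (inverse (f x) * frechet_derivative f (at x) v * inverse (f x)))" for v
    by (intro Ck_on_bounded_linear_left[where h = uminus] bounded_linear_minus bounded_linear_ident
        Ck_on_mult assms(1)) simp_all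
  have "((\<lambda>x. inverse (f x)) has_derivative
      (\<lambda>v. - (inverse (f x) * frechet_derivative f (at x) v * inverse (f x)))) (at x)" if "x \<in> S" for x
    using that Suc.prems by (intro Deriv.has_derivative_inverse assms(2) Ck_on_SucD)
  then show ?case
    by (rule Ck_on_SucI[OF assms(1) _ D])
qed

lemma Ck_on_divide:
  fixes f g :: "'a::euclidean_space \<Rightarrow> real"
  assumes "open S" "\<And>x. x \<in> S \<Longrightarrow> g x \<noteq> 0" "Ck_on k S f" "Ck_on k S g"
  shows "Ck_on k S (\<lambda>x. f x / g x)"
  unfolding divide_inverse by (intro Ck_on_mult Ck_on_inverse assms)

lemma Ck_on_exp:
  fixes f :: "'a::euclidean_space \<Rightarrow> real"
  assumes "open S" "Ck_on k S f"
  shows "Ck_on k S (\<lambda>x. exp (f x))"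
  using assms(2)
proof (induction k)
  case 0
  then show ?case by (simp add: continuous_on_exp)
next
  case (Suc k)
  have "Ck_on k S (\<lambda>x. exp (f x))" "Ck_on k S (\<lambda>x. frechet_derivative f (at x) v)" for v
    using Suc Ck_on_Suc_imp[OF Suc.prems] by simp_all
  then have D: "Ck_on k S (\<lambda>x. frechet_derivative f (at x) v * exp (f x))" for v
    by (intro Ck_on_mult assms(1))
  have "((\<lambda>x. exp (f x)) has_derivative (\<lambda>v. frechet_derivative f (at x) v * exp (f x))) (at x)"
    if "x \<in> S" for x
    using that Suc.prems by (intro has_derivative_exp Ck_on_SucD)
  then show ?case
    by (rule Ck_on_SucI[OF assms(1) _ D])
qed

section \<open>Determinants and smoothness of inverse maps\<close>

lemma Ck_on_det:
  fixes M :: "'a::euclidean_space \<Rightarrow> real^'n^'n"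
  assumes "open S" "\<And>i j. Ck_on k S (\<lambda>x. M x $ i $ j)"
  shows "Ck_on k S (\<lambda>x. det (M x))"
  unfolding det_def by (intro Ck_on_sum Ck_on_mult Ck_on_prod Ck_on_const assms)

text \<open>
  The chain rule \<open>D(h \<circ> g)(f x) v = Dh(x) (Df(x)\<^sup>-\<^sup>1 v)\<close> keeps the derivative of the form
  \<open>h' \<circ> g\<close> with \<open>h'\<close> smooth by Cramer's rule, so the induction runs over all smooth \<open>h\<close> at once.
\<close>

lemma Ck_on_compose_inverse:
  fixes f g :: "real^'n \<Rightarrow> real^'n" and h :: "real^'n \<Rightarrow> 'b::euclidean_space"
  assumes S: "open S" and T: "open (f ` S)" and f: "smooth_on S f"
    and inj: "\<And>x. x \<in> S \<Longrightarrow> inj (frechet_derivative f (at x))"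
    and gf: "\<And>x. x \<in> S \<Longrightarrow> g (f x) = x"
    and "smooth_on S h"
  shows "Ck_on k (f ` S) (\<lambda>y. h (g y))"
proof -
  define J where "J x = matrix (frechet_derivative f (at x))" for x
  \<comment> \<open>Cramer's rule: column \<open>k\<close> of \<open>J x\<close> is replaced by
    \<open>v\<close>. Thus \<open>G x\<close> is the inverse of the derivative of \<open>f\<close>
    at \<open>x\<close>, written as a rational expression in the entries.\<close>
  define G where "G x v = (\<chi> k. det (\<chi> i j. if j = k then v $ i else J x $ i $ j) / det (J x))" for x v
  have Df: "(f has_derivative frechet_derivative f (at x)) (at x)" if "x \<in> S" for x
    by (rule smooth_on_imp_has_derivative[OF f that])
  have J: "frechet_derivative f (at x) v = J x *v v" if "x \<in> S" for x v
    unfolding J_def using has_derivative_linear[OF Df[OF that]]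
    by (simp add: matrix_works linear_matrix_vector_mul_eq)
  have det: "det (J x) \<noteq> 0" if "x \<in> S" for x
    unfolding J_def using det_nz_iff_inj[OF has_derivative_linear[OF Df[OF that]]] inj[OF that] by simp
  have JG: "J x *v G x v = v" if "x \<in> S" for x v
    using cramer[OF det[OF that]] unfolding G_def by blast
  have contf: "continuous_on S f"
    by (rule smooth_on_imp_continuous_on[OF f])
  have Dg: "(g has_derivative G x) (at (f x))" if "x \<in> S" for x
    by (rule has_derivative_inverse_strong[OF S that contf gf Df[OF that]])
      (auto simp: J[OF that] JG[OF that])
  have Jk: "Ck_on k S (\<lambda>x. J x $ i $ j)" for k i j
  proof -
    have "Ck_on k S (\<lambda>x. frechet_derivative f (at x) (axis j 1))"
      by (rule smooth_on_imp_Ck_on_derivative[OF f])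
    then show ?thesis
      unfolding J_def matrix_def by (simp add: Ck_on_bounded_linear_left[OF S bounded_linear_vec_nth])
  qed
  have Gk: "Ck_on k S (\<lambda>x. G x v $ j)" for k v j
  proof -
    \<comment> \<open>Whether an entry lies in the replaced column does not depend on
      \<open>x\<close>: each entry is either constant or an entry of \<open>J x\<close>.\<close>
    have "Ck_on k S (\<lambda>x. if b then v $ i else J x $ i $ l)" for b i l
      by (cases b) (simp_all add: Jk Ck_on_const)
    then show ?thesis
      unfolding G_def vec_lambda_beta by (intro Ck_on_divide Ck_on_det S det Jk) simp_all
  qed
  show ?thesis
    using \<open>smooth_on S h\<close>
  proof (induction k arbitrary: h)
    case 0
    have "continuous_on S h"
      by (rule smooth_on_imp_continuous_on[OF 0])
    moreover have "continuous_on (f ` S) g"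
      by (intro continuous_at_imp_continuous_on) (auto intro: has_derivative_continuous[OF Dg])
    moreover have "g ` f ` S \<subseteq> S"
      using gf by auto
    ultimately show ?case
      by (simp add: continuous_on_compose2)
  next
    case (Suc k)
    have Dh: "(h has_derivative frechet_derivative h (at x)) (at x)" if "x \<in> S" for x
      by (rule smooth_on_imp_has_derivative[OF Suc.prems that])
    \<comment> \<open>Smoothness of \<open>h\<close> controls its derivative along fixed vectors
      only, so the varying vector \<open>G x v\<close> is expanded in the standard basis.\<close>
    have "Ck_on n S (\<lambda>x. \<Sum>i\<in>UNIV. (G x v $ i) *\<^sub>R frechet_derivative h (at x) (axis i 1))" for n v
      by (intro Ck_on_sum Ck_on_scaleR S Gk smooth_on_imp_Ck_on_derivative[OF Suc.prems])
    moreover have hG: "frechet_derivative h (at x) (G x v)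
        = (\<Sum>i\<in>UNIV. (G x v $ i) *\<^sub>R frechet_derivative h (at x) (axis i 1))" if "x \<in> S" for x v
    proof -
      have lin: "linear (frechet_derivative h (at x))"
        by (rule has_derivative_linear[OF Dh[OF that]])
      have "G x v = (\<Sum>i\<in>UNIV. (G x v $ i) *\<^sub>R axis i 1)"
        using basis_expansion[of "G x v"] by (simp add: scalar_mult_eq_scaleR)
      then have "frechet_derivative h (at x) (G x v)
          = frechet_derivative h (at x) (\<Sum>i\<in>UNIV. (G x v $ i) *\<^sub>R axis i 1)"
        by (rule arg_cong)
      then show ?thesis
        by (simp add: linear_sum[OF lin] linear_scale[OF lin])
    qed
    ultimately have "smooth_on S (\<lambda>x. frechet_derivative h (at x) (G x v))" for v
      unfolding smooth_on_def by (simp add: Ck_on_cong[OF S hG])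
    then have D: "Ck_on k (f ` S) (\<lambda>y. frechet_derivative h (at (g y)) (G (g y) v))" for v
      by (rule Suc.IH)
    have "((\<lambda>y. h (g y)) has_derivative (\<lambda>v. frechet_derivative h (at (g y)) (G (g y) v))) (at y)"
      if "y \<in> f ` S" for y
    proof -
      obtain x where x: "x \<in> S" "y = f x" using \<open>y \<in> f ` S\<close> by blast
      with gf have "g y = x" by simp
      with x show ?thesis
        using has_derivative_compose[OF Dg[OF x(1)], of h "frechet_derivative h (at x)"] Dh[OF x(1)]
        by simp
    qed
    then show ?case
      by (rule Ck_on_SucI[OF T _ D])
  qed
qed

text \<open>Invariance of domain makes the image open, and the composition result with the identity
  as \<open>h\<close> makes the inverse smooth.\<close>

theorem diffeomorphism_onto_image:
  fixes f :: "real^'n \<Rightarrow> real^'n"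
  assumes S: "open S" and f: "smooth_on S f" and "inj_on f S"
    and inj: "\<And>x. x \<in> S \<Longrightarrow> inj (frechet_derivative f (at x))"
  shows "diffeomorphism S (f ` S) f"
proof -
  have "continuous_on S f"
    by (rule smooth_on_imp_continuous_on[OF f])
  then have T: "open (f ` S)"
    using S \<open>inj_on f S\<close> by (rule invariance_of_domain)
  have "smooth_on S (\<lambda>x. x)"
    using Ck_on_bounded_linear[OF S bounded_linear_ident] by (simp add: smooth_on_def)
  then have "Ck_on k (f ` S) (inv_into S f)" for k
    using Ck_on_compose_inverse[OF S T f inj, of "inv_into S f" "\<lambda>x. x"] \<open>inj_on f S\<close> by simp
  then show ?thesis
    using S T f \<open>inj_on f S\<close> by (simp add: diffeomorphism_def smooth_on_def bij_betw_def)
qed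

section \<open>Monotone maps, minima of coercive functions, and convex hulls\<close>

text \<open>Along the segment from \<open>x\<close> to \<open>y\<close>, the component of
  \<open>f\<close> in the direction \<open>y - x\<close> is strictly increasing, so the two end
  values differ.\<close>

lemma inj_if_derivative_positive:
  fixes f :: "'a::euclidean_space \<Rightarrow> 'a"
  assumes df: "\<And>x. (f has_derivative f' x) (at x)"
    and pos: "\<And>x v. v \<noteq> 0 \<Longrightarrow> v \<bullet> f' x v > 0"
  shows "inj f"
proof (rule injI, rule ccontr)
  fix x y assume "f x = f y" "x \<noteq> y"
  define \<phi> where "\<phi> t = (y - x) \<bullet> f (x + t *\<^sub>R (y - x))" for t
  have d\<phi>: "(\<phi> has_real_derivative (y - x) \<bullet> f' (x + t *\<^sub>R (y - x)) (y - x)) (at t)" for t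
  proof -
    have lin: "linear (f' z)" for z
      by (rule has_derivative_linear[OF df])
    have "((\<lambda>t. x + t *\<^sub>R (y - x)) has_derivative (\<lambda>h. h *\<^sub>R (y - x))) (at t)"
      by (auto intro!: derivative_eq_intros)
    then have "(\<phi> has_derivative (\<lambda>h. (y - x) \<bullet> f' (x + t *\<^sub>R (y - x)) (h *\<^sub>R (y - x)))) (at t)"
      unfolding \<phi>_def[abs_def]
      by (rule has_derivative_inner_right[OF has_derivative_compose[OF _ df]])
    then show ?thesis
      by (simp add: has_field_derivative_def linear_scale[OF lin] mult_commute_abs)
  qed
  have "\<phi> 0 < \<phi> 1"
  proof (rule DERIV_pos_imp_increasing[where f = \<phi>])
    fix t :: real
    have "(y - x) \<bullet> f' (x + t *\<^sub>R (y - x)) (y - x) > 0"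
      using \<open>x \<noteq> y\<close> by (intro pos) simp
    with d\<phi> show "\<exists>D. (\<phi> has_real_derivative D) (at t) \<and> D > 0"
      by blast
  qed simp
  with \<open>f x = f y\<close> show False
    by (simp add: \<phi>_def)
qed

text \<open>Outside the ball of radius \<open>R\<close> the lower bound already reaches
  \<open>F 0\<close>, so a minimum over this compact ball is global.\<close>

lemma attains_min_if_coercive:
  fixes F :: "'a::euclidean_space \<Rightarrow> real"
  assumes "continuous_on UNIV F" "r > 0" "\<And>x. F x \<ge> c + r * norm x"
  obtains x where "\<And>y. F x \<le> F y"
proof -
  \<comment> \<open>The maximum with 0 keeps the origin in the ball even when \<open>F 0 < c\<close>
    is not excluded beforehand; the comparison with \<open>F 0\<close> uses this.\<close>
  define R where "R = max 0 ((F 0 - c) / r)"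
  obtain x where x: "x \<in> cball 0 R" "\<And>y. y \<in> cball 0 R \<Longrightarrow> F x \<le> F y"
    using continuous_attains_inf[of "cball 0 R" F] continuous_on_subset[OF assms(1)]
    by (auto simp: R_def)
  have "F x \<le> F y" for y
  proof (cases "y \<in> cball 0 R")
    case False
    then have "(F 0 - c) / r \<le> norm y"
      by (simp add: R_def)
    then have "F 0 - c \<le> r * norm y"
      using \<open>r > 0\<close> by (simp add: field_simps)
    moreover have "F x \<le> F 0"
      by (rule x) (simp add: R_def)
    ultimately show ?thesis
      using assms(3)[of y] by linarith
  qed (use x in auto)
  then show thesis
    using that by blast
qed

text \<open>Otherwise \<open>A\<close>, and by convexity its hull, would lie in an open half-space
  that does not contain \<open>b\<close>.\<close>

lemma exists_inner_ge:
  fixes A :: "'a::real_inner set"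
  assumes "b \<in> convex hull A"
  shows "\<exists>a\<in>A. a \<bullet> x \<ge> b \<bullet> x"
proof (rule ccontr)
  assume "\<not> ?thesis"
  then have "A \<subseteq> {y. x \<bullet> y < b \<bullet> x}"
    by (auto simp: inner_commute not_le)
  then have "convex hull A \<subseteq> {y. x \<bullet> y < b \<bullet> x}"
    by (intro hull_minimal convex_halfspace_lt)
  with assms show False
    by (auto simp: inner_commute)
qed

section \<open>The weights on \<open>A\<close>, their mean, and the gradient of
  \<open>Phi\<close>\<close>

locale weighted_points =
  fixes A :: "(real^'m) set" and \<alpha> :: "real^'m \<Rightarrow> real"
  assumes finite: "finite A"
    and full_dim: "aff_dim A = int CARD('m)"
    and pos: "a \<in> A \<Longrightarrow> \<alpha> a > 0"
begin

definition Z :: "real^'m \<Rightarrow> real" where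
  "Z x = (\<Sum>a\<in>A. (\<alpha> a)\<^sup>2 * exp (2 * (a \<bullet> x)))"

definition p :: "real^'m \<Rightarrow> real^'m \<Rightarrow> real" where
  "p x a = (\<alpha> a)\<^sup>2 * exp (2 * (a \<bullet> x)) / Z x"

definition mu :: "real^'m \<Rightarrow> real^'m" where
  "mu x = (\<Sum>a\<in>A. p x a *\<^sub>R a)"

text \<open>This is twice the covariance operator. Centering one factor is enough, because the
  centered values have mean zero.\<close>

definition Dmu :: "real^'m \<Rightarrow> real^'m \<Rightarrow> real^'m" where
  "Dmu x v = (\<Sum>a\<in>A. (2 * p x a * ((a - mu x) \<bullet> v)) *\<^sub>R a)"

text \<open>The empty set has affine dimension -1, which is not a cardinality.\<close>

lemma nonempty: "A \<noteq> {}"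
  using full_dim by auto

lemma Z_pos: "Z x > 0"
  unfolding Z_def by (intro sum_pos finite nonempty mult_pos_pos) (auto dest: pos)

lemma p_pos: "a \<in> A \<Longrightarrow> p x a > 0"
  using pos[of a] Z_pos[of x] by (simp add: p_def)

lemma sum_p: "(\<Sum>a\<in>A. p x a) = 1"
  using Z_pos[of x] by (simp add: p_def sum_divide_distrib[symmetric] Z_def[symmetric])

text \<open>The factor \<open>Z x\<close> is split off so that division by it leaves
  \<open>mu x\<close>; both the gradient of \<open>Phi\<close> and the derivative of the weights
  follow from this form.\<close>

lemma has_derivative_Z: "(Z has_derivative (\<lambda>v. 2 * Z x * (mu x \<bullet> v))) (at x)"
proof -
  have "Z x * (mu x \<bullet> v) = (\<Sum>a\<in>A. (\<alpha> a)\<^sup>2 * exp (2 * (a \<bullet> x)) * (a \<bullet> v))" for v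
    using Z_pos[of x]
    by (simp add: mu_def p_def inner_sum_left sum_distrib_left)
  then have "2 * Z x * (mu x \<bullet> v) = (\<Sum>a\<in>A. (\<alpha> a)\<^sup>2 * (exp (2 * (a \<bullet> x)) * (2 * (a \<bullet> v))))" for v
    by (simp add: mult.assoc sum_distrib_left mult.left_commute)
  then show ?thesis
    unfolding Z_def[abs_def] by (auto intro!: derivative_eq_intros sum.cong)
qed

lemma GDERIV_Phi: "GDERIV (Phi A \<alpha>) x :> mu x"
proof -
  have "((\<lambda>x. (1/2) * ln (Z x)) has_derivative (\<lambda>v. v \<bullet> mu x)) (at x)"
    using Z_pos[of x] by (auto intro!: derivative_eq_intros has_derivative_Z simp: inner_commute)
  then show ?thesis
    by (simp add: gderiv_def Phi_def[abs_def] Z_def)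
qed

text \<open>Existence of the gradient alone does not evaluate the definite description; uniqueness
  comes from uniqueness of derivatives.\<close>

lemma moment_map_eq: "moment_map A \<alpha> = mu"
proof
  fix x
  show "moment_map A \<alpha> x = mu x"
    unfolding moment_map_def
  proof (rule the_equality, rule GDERIV_Phi)
    fix D assume "GDERIV (Phi A \<alpha>) x :> D"
    then have "(\<lambda>v. v \<bullet> D) = (\<lambda>v. v \<bullet> mu x)"
      using has_derivative_unique[OF _ GDERIV_Phi[unfolded gderiv_def]] by (simp add: gderiv_def)
    then show "D = mu x"
      by (metis vector_eq_ldot)
  qed
qed

section \<open>The derivative of \<open>mu\<close> is positive definite\<close>

lemma has_derivative_p: "((\<lambda>x. p x a) has_derivative (\<lambda>v. 2 * p x a * ((a - mu x) \<bullet> v))) (at x)"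
  unfolding p_def[abs_def] using Z_pos[of x]
  by (auto intro!: derivative_eq_intros has_derivative_Z
      simp: field_simps inner_diff_left power2_eq_square)

lemma has_derivative_mu: "(mu has_derivative Dmu x) (at x)"
proof -
  have "((\<lambda>x. \<Sum>a\<in>A. p x a *\<^sub>R a) has_derivative Dmu x) (at x)"
    unfolding Dmu_def[abs_def] by (intro has_derivative_sum has_derivative_scaleR_left has_derivative_p)
  then show ?thesis
    by (simp add: mu_def[abs_def])
qed

lemma sum_p_centered: "(\<Sum>a\<in>A. p x a * ((a - mu x) \<bullet> v)) = 0"
proof -
  have "(\<Sum>a\<in>A. p x a * ((a - mu x) \<bullet> v)) = (\<Sum>a\<in>A. p x a *\<^sub>R a) \<bullet> v - (\<Sum>a\<in>A. p x a) * (mu x \<bullet> v)"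
    by (simp add: inner_sum_left inner_diff_left algebra_simps sum_subtractf sum_distrib_right)
  then show ?thesis
    by (simp add: sum_p mu_def)
qed

lemma inner_Dmu: "v \<bullet> Dmu x v = 2 * (\<Sum>a\<in>A. p x a * ((a - mu x) \<bullet> v)\<^sup>2)"
proof -
  have "v \<bullet> Dmu x v = 2 * (\<Sum>a\<in>A. p x a * ((a - mu x) \<bullet> v) * (a \<bullet> v))"
    by (simp add: Dmu_def inner_sum_right sum_distrib_left mult.assoc inner_commute)
  \<comment> \<open>Write \<open>a\<close> as \<open>(a - mu x) + mu x\<close>; the second part
    contributes a multiple of the vanishing centered sum.\<close>
  also have "(\<Sum>a\<in>A. p x a * ((a - mu x) \<bullet> v) * (a \<bullet> v))
      = (\<Sum>a\<in>A. p x a * ((a - mu x) \<bullet> v)\<^sup>2) + (mu x \<bullet> v) * (\<Sum>a\<in>A. p x a * ((a - mu x) \<bullet> v))"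
    by (simp add: sum_distrib_left sum.distrib[symmetric])
       (simp add: algebra_simps inner_diff_left power2_eq_square)
  finally show ?thesis
    by (simp add: sum_p_centered)
qed

lemma inner_Dmu_pos:
  assumes "v \<noteq> 0"
  shows "v \<bullet> Dmu x v > 0"
proof (rule ccontr)
  assume "\<not> ?thesis"
  moreover have nonneg: "p x a * ((a - mu x) \<bullet> v)\<^sup>2 \<ge> 0" if "a \<in> A" for a
    using p_pos[OF that, of x] by simp
  ultimately have "(\<Sum>a\<in>A. p x a * ((a - mu x) \<bullet> v)\<^sup>2) = 0"
    using sum_nonneg[of A "\<lambda>a. p x a * ((a - mu x) \<bullet> v)\<^sup>2"] by (force simp: inner_Dmu)
  then have "\<forall>a\<in>A. p x a * ((a - mu x) \<bullet> v)\<^sup>2 = 0"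
    using nonneg finite by (simp add: sum_nonneg_eq_0_iff)
  then have "(a - mu x) \<bullet> v = 0" if "a \<in> A" for a
    using p_pos[OF that, of x] that by fastforce
  \<comment> \<open>All weights are positive, so a vanishing variance in direction \<open>v\<close>
    puts every point of \<open>A\<close> on one hyperplane, against full dimension.\<close>
  then have "A \<subseteq> {a. v \<bullet> a = v \<bullet> mu x}"
    by (auto simp: inner_diff_left inner_commute[of v])
  then have "aff_dim A \<le> aff_dim {a. v \<bullet> a = v \<bullet> mu x}"
    by (rule aff_dim_subset)
  with assms full_dim show False
    by simp
qed

lemma smooth_mu: "smooth_on UNIV mu"
proof -
  have w: "Ck_on k UNIV (\<lambda>x. (\<alpha> a)\<^sup>2 * exp (2 * (a \<bullet> x)))" for k a
    by (intro Ck_on_mult Ck_on_const Ck_on_exp Ck_on_bounded_linear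
        bounded_linear_inner_right) simp_all
  have "Ck_on k UNIV Z" for k
    unfolding Z_def[abs_def] by (intro Ck_on_sum w) simp
  moreover have "Z x \<noteq> 0" for x
    using Z_pos[of x] by simp
  ultimately have "Ck_on k UNIV (\<lambda>x. p x a)" for k a
    unfolding p_def[abs_def] by (intro Ck_on_divide w) simp_all
  then show ?thesis
    unfolding smooth_on_def mu_def[abs_def] by (intro allI Ck_on_sum Ck_on_scaleR Ck_on_const) simp_all
qed

section \<open>The image of \<open>mu\<close>\<close>

lemma mu_in_hull: "mu x \<in> convex hull A"
  using p_pos[of _ x] sum_p[of x] by (auto simp: convex_hull_finite[OF finite] mu_def intro: less_imp_le)

text \<open>Keeping a single term under the logarithm gives an affine lower bound for each point of
  \<open>A\<close>; together these bounds yield coercivity.\<close>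

lemma Phi_ge: "a \<in> A \<Longrightarrow> Phi A \<alpha> x \<ge> ln (\<alpha> a) + a \<bullet> x"
proof -
  assume a: "a \<in> A"
  have "2 * (ln (\<alpha> a) + a \<bullet> x) = ln ((\<alpha> a)\<^sup>2 * exp (2 * (a \<bullet> x)))"
    using pos[OF a] by (simp add: ln_mult ln_realpow)
  also have "\<dots> \<le> ln (Z x)"
    using pos[OF a] Z_pos[of x] unfolding Z_def
    by (subst ln_le_cancel_iff) (auto intro: member_le_sum finite a)
  finally show ?thesis
    by (simp add: Phi_def Z_def)
qed

lemma interior_subset_range: "interior (convex hull A) \<subseteq> range mu"
proof
  fix b assume "b \<in> interior (convex hull A)"
  then obtain r where r: "r > 0" "cball b r \<subseteq> convex hull A"
    by (auto simp: mem_interior_cball)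
  \<comment> \<open>The point of \<open>A\<close> chosen below depends on \<open>x\<close>; the
    minimum over the finite set makes the constant uniform.\<close>
  define c where "c = Min ((\<lambda>a. ln (\<alpha> a)) ` A)"
  define F where "F x = Phi A \<alpha> x - b \<bullet> x" for x
  have DF: "(F has_derivative (\<lambda>v. v \<bullet> mu x - b \<bullet> v)) (at x)" for x
    unfolding F_def[abs_def] using GDERIV_Phi[of x]
    by (auto intro!: derivative_eq_intros simp: gderiv_def)
  have "F x \<ge> c + r * norm x" for x
  proof -
    \<comment> \<open>Moving from \<open>b\<close> by \<open>r\<close> in the direction of
      \<open>x\<close> stays in the hull and gains exactly \<open>r * norm x\<close> in the inner
      product with \<open>x\<close>. Since \<open>sgn 0 = 0\<close>, the origin is covered
      too.\<close>
    have "b + r *\<^sub>R sgn x \<in> convex hull A"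
      using r by (intro subsetD[OF r(2)]) (auto simp: dist_norm norm_sgn)
    then obtain a where a: "a \<in> A" "a \<bullet> x \<ge> (b + r *\<^sub>R sgn x) \<bullet> x"
      using exists_inner_ge by blast
    have "sgn x \<bullet> x = norm x"
      by (cases "x = 0") (simp_all add: sgn_div_norm power2_norm_eq_inner[symmetric] power2_eq_square)
    moreover have "c \<le> ln (\<alpha> a)"
      unfolding c_def using a finite by simp
    ultimately show ?thesis
      using Phi_ge[OF a(1), of x] a(2) by (simp add: F_def inner_add_left)
  qed
  moreover have "continuous_on UNIV F"
    by (rule has_derivative_continuous_on[OF DF])
  ultimately obtain x where "\<And>y. F x \<le> F y"
    using attains_min_if_coercive[of F r c] r(1) by blast
  then have "(\<lambda>v. v \<bullet> mu x - b \<bullet> v) = (\<lambda>v. 0)"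
    by (intro differential_zero_maxmin[OF _ open_UNIV DF]) auto
  then have "\<forall>v. v \<bullet> mu x = v \<bullet> b"
    by (metis eq_iff_diff_eq_0 inner_commute)
  then have "mu x = b"
    by (simp add: vector_eq_ldot)
  then show "b \<in> range mu"
    by blast
qed

lemma diffeomorphism_mu: "diffeomorphism UNIV (interior (convex hull A)) mu"
proof -
  have "inj mu"
    using has_derivative_mu inner_Dmu_pos by (rule inj_if_derivative_positive)
  have "inj (frechet_derivative mu (at x))" for x
  proof -
    have "linear (Dmu x)"
      by (rule has_derivative_linear[OF has_derivative_mu])
    moreover have "v = 0" if "Dmu x v = 0" for v
      using inner_Dmu_pos[of v x] that by (cases "v = 0") simp_all
    ultimately have "inj (Dmu x)"
      by (simp add: linear_injective_0)
    then show ?thesis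
      by (simp add: frechet_derivative_at[OF has_derivative_mu, symmetric])
  qed
  with smooth_mu \<open>inj mu\<close> have *: "diffeomorphism UNIV (range mu) mu"
    by (intro diffeomorphism_onto_image) simp_all
  \<comment> \<open>The image is open and contained in the hull, hence contained in its
    interior.\<close>
  then have "range mu \<subseteq> interior (convex hull A)"
    using mu_in_hull by (intro interior_maximal) (auto simp: diffeomorphism_def)
  with interior_subset_range have "range mu = interior (convex hull A)"
    by blast
  with * show ?thesis
    by simp
qed

end

theorem lemma4p6:
  fixes A :: "(real^'m) set" and \<alpha> :: "real^'m \<Rightarrow> real"
  assumes "finite A"
    and "aff_dim (convex hull A) = int CARD('m)"
    and "\<forall>a\<in>A. \<alpha> a > 0"
  shows "(\<forall>x. GDERIV (Phi A \<alpha>) x :> moment_map A \<alpha> x) \<and>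
    (\<forall>x. moment_map A \<alpha> x =
       (\<Sum>a\<in>A. ((\<alpha> a)\<^sup>2 * exp (2 * (a \<bullet> x)) /
                 (\<Sum>a'\<in>A. (\<alpha> a')\<^sup>2 * exp (2 * (a' \<bullet> x)))) *\<^sub>R a)) \<and>
    diffeomorphism UNIV (interior (convex hull A)) (moment_map A \<alpha>)"
proof -
  interpret weighted_points A \<alpha>
    using assms by unfold_locales (auto simp: aff_dim_convex_hull)
  show ?thesis
    using GDERIV_Phi diffeomorphism_mu by (simp add: moment_map_eq) (simp add: mu_def p_def Z_def)
qed

end
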